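(* Let $n\ge2$ and let $K_0:S_n\to S_n$ be the short systematic scan at $\theta=0$. Then $K_0$ acts on $w\in S_n$ as follows: writing $u=w^{-1}$ in one-line notation $u=(u_1,\dots,u_n)$, it successively compares the entries in positions $i,i+1$ for $i=1,2,\dots,n-1$ and then for $i=n-1,\dots,1$, and transposes the two entries at each comparison exactly when they are in increasing order. Started at the identity, for $1\le t\le\lfloor n/2\rfloor$ the $t$-th scan transposes the values $t$ and $n+1-t$ and changes nothing else, so that after $t$ scans the state is $$K_0^t(\mathrm{id})=(1\;\,n)(2\;\,n-1)\cdots(t\;\,n+1-t).$$ In particular the $n-2t$ values $t+1,\dots,n-t$ are still in their original increasing order, whence $$D=\binom{n-2t}{2},\qquad\ell=\binom n2-\binom{n-2t}{2}=2tn-2t^2-t,$$ and, starting from the identity, the longest element $w_0$ is first reached at $t=\lfloor n/2\rfloor$.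
   Context: $s_i=(i\ i+1)$; permutations compose right to left; $\ell(w)$ is the number of inversions of $w$, $D(w)=\binom n2-\ell(w)$ the number of non-inversions; in the claim $\ell$ and $D$ are evaluated at the state $K_0^t(\mathrm{id})$. $w_0$ is the longest element of $S_n$. Define $s_i\star w=s_iw$ if $\ell(s_iw)>\ell(w)$ and $s_i\star w=w$ otherwise. The short systematic scan at $\theta=0$ is the deterministic map $$K_0(w)=s_{n-1}\star(\cdots\star(s_2\star(s_1\star(s_1\star(s_2\star\cdots\star(s_{n-1}\star w))))))$$ i.e. left multiplication by $\widetilde T_{s_{n-1}}\cdots\widetilde T_{s_2}\widetilde T_{s_1}^2\widetilde T_{s_2}\cdots\widetilde T_{s_{n-1}}$ in the algebra with basis $\{\widetilde T_w\}$ and $\widetilde T_{s_i}\widetilde T_w=\widetilde T_{s_i\star w}$. (As a map it equals left multiplication by $\widetilde T_{(1\,n)}$ in that algebra, $(1\,n)$ having the two reduced words $s_1\cdots s_{n-1}s_{n-2}\cdots s_1$ and $s_{n-1}\cdots s_2s_1s_2\cdots s_{n-1}$.) *)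

theory Defs
  imports "HOL-Combinatorics.Combinatorics"
begin

text \<open>
  The symmetric group \<open>S\<^sub>n\<close> is the set of functions \<open>w\<close> on the naturals with
  \<open>w permutes {1..n}\<close>; products are composed right to left, and \<open>s\<^sub>i\<close> is
  \<open>transpose i (i + 1)\<close>.
\<close>

definition inversions :: "nat \<Rightarrow> (nat \<Rightarrow> nat) \<Rightarrow> (nat \<times> nat) set" where
  "inversions n w = {(i, j). i \<in> {1..n} \<and> j \<in> {1..n} \<and> i < j \<and> w j < w i}"

definition perm_length :: "nat \<Rightarrow> (nat \<Rightarrow> nat) \<Rightarrow> nat" where
  "perm_length n w = card (inversions n w)"

definition non_inversions :: "nat \<Rightarrow> (nat \<Rightarrow> nat) \<Rightarrow> (nat \<times> nat) set" where
  "non_inversions n w = {(i, j). i \<in> {1..n} \<and> j \<in> {1..n} \<and> i < j \<and> w i < w j}"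

definition perm_defect :: "nat \<Rightarrow> (nat \<Rightarrow> nat) \<Rightarrow> nat" where
  "perm_defect n w = card (non_inversions n w)"

definition longest_element :: "nat \<Rightarrow> nat \<Rightarrow> nat" where
  "longest_element n = (THE w. w permutes {1..n} \<and>
     (\<forall>v. v permutes {1..n} \<longrightarrow> perm_length n v \<le> perm_length n w))"

definition star_action :: "nat \<Rightarrow> nat \<Rightarrow> (nat \<Rightarrow> nat) \<Rightarrow> nat \<Rightarrow> nat" where
  "star_action n i w =
     (let v = transpose i (i + 1) \<circ> w
      in if perm_length n v > perm_length n w then v else w)"

text \<open>
  As \<open>foldr f [a, \<dots>, z] w = f a (\<dots> (f z w))\<close>, the list of indices is read here as
  in the displayed product \<open>s\<^sub>n\<^sub>-\<^sub>1 \<star> (\<dots> (s\<^sub>1 \<star> (s\<^sub>1 \<star> (\<dots> (s\<^sub>n\<^sub>-\<^sub>1 \<star> w)))))\<close>, so that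
  the rightmost index acts first.
\<close>

definition short_scan :: "nat \<Rightarrow> (nat \<Rightarrow> nat) \<Rightarrow> nat \<Rightarrow> nat" where
  "short_scan n w = foldr (star_action n) (rev [1..<n] @ [1..<n]) w"

definition one_line :: "nat \<Rightarrow> (nat \<Rightarrow> nat) \<Rightarrow> nat list" where
  "one_line n u = map u [1..<n + 1]"

text \<open>Positions are counted from 1, list indices from 0.\<close>

definition compare_swap :: "nat \<Rightarrow> nat list \<Rightarrow> nat list" where
  "compare_swap i us =
     (let a = us ! (i - 1); b = us ! i
      in if a < b then us[i - 1 := b, i := a] else us)"

definition mirror_product :: "nat \<Rightarrow> nat \<Rightarrow> nat \<Rightarrow> nat" where
  "mirror_product n t = foldr (\<circ>) (map (\<lambda>i. transpose i (n + 1 - i)) [1..<t + 1]) id"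

lemma card_ordered_pairs:
  "card {(i::nat, j). i \<in> {1..n} \<and> j \<in> {1..n} \<and> i < j} = n choose 2"
proof -
  have "bij_betw (\<lambda>(i, j). {i, j}) {(i::nat, j). i \<in> {1..n} \<and> j \<in> {1..n} \<and> i < j}
          {A. A \<subseteq> {1..n} \<and> card A = 2}"
    unfolding bij_betw_def
  proof
    show "inj_on (\<lambda>(i, j). {i, j}) {(i::nat, j). i \<in> {1..n} \<and> j \<in> {1..n} \<and> i < j}"
      by (auto simp: inj_on_def doubleton_eq_iff)
    show "(\<lambda>(i, j). {i, j}) ` {(i::nat, j). i \<in> {1..n} \<and> j \<in> {1..n} \<and> i < j}
            = {A. A \<subseteq> {1..n} \<and> card A = 2}"
    proof (intro equalityI subsetI)
      fix A :: "nat set"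
      assume "A \<in> {A. A \<subseteq> {1..n} \<and> card A = 2}"
      then obtain x y where A: "A = {x, y}" "x \<noteq> y" "A \<subseteq> {1..n}"
        by (auto simp: card_2_iff)
      show "A \<in> (\<lambda>(i, j). {i, j}) ` {(i, j). i \<in> {1..n} \<and> j \<in> {1..n} \<and> i < j}"
      proof (cases "x < y")
        case True
        then show ?thesis using A by (intro image_eqI[of _ _ "(x, y)"]) auto
      next
        case False
        then show ?thesis using A by (intro image_eqI[of _ _ "(y, x)"]) auto
      qed
    qed auto
  qed
  then have "card {(i::nat, j). i \<in> {1..n} \<and> j \<in> {1..n} \<and> i < j}
      = card {A. A \<subseteq> {1..n} \<and> card A = 2}"
    by (rule bij_betw_same_card)
  then show ?thesis
    using n_subsets[of "{1..n}" 2] by simp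
qed

lemma finite_ordered_pairs: "finite {(i::nat, j). i \<in> {1..n} \<and> j \<in> {1..n} \<and> i < j}"
  by (rule finite_subset[of _ "{1..n} \<times> {1..n}"]) auto

lemma perm_length_plus_defect:
  assumes "w permutes {1..n}"
  shows "perm_length n w + perm_defect n w = n choose 2"
proof -
  have ne: "w i < w j \<or> w j < w i" if "i < j" for i j
    using permutes_inj[OF assms] that by (metis injD less_irrefl linorder_neqE_nat)
  have un: "inversions n w \<union> non_inversions n w
      = {(i, j). i \<in> {1..n} \<and> j \<in> {1..n} \<and> i < j}"
    unfolding inversions_def non_inversions_def using ne by blast
  then have fin: "finite (inversions n w)" "finite (non_inversions n w)"
    using finite_ordered_pairs[of n] by (metis finite_Un)+
  have disj: "inversions n w \<inter> non_inversions n w = {}"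
    by (auto simp: inversions_def non_inversions_def)
  show ?thesis
    using card_Un_disjoint[OF fin disj]
    unfolding perm_length_def perm_defect_def un card_ordered_pairs by simp
qed

corollary perm_defect_eq:
  "w permutes {1..n} \<Longrightarrow> perm_defect n w = (n choose 2) - perm_length n w"
  using perm_length_plus_defect[of w n] by simp

definition reversal :: "nat \<Rightarrow> nat \<Rightarrow> nat" where
  "reversal n i = (if i \<in> {1..n} then n + 1 - i else i)"

lemma reversal_permutes: "reversal n permutes {1..n}"
proof (rule bij_imp_permutes)
  show "bij_betw (reversal n) {1..n} {1..n}"
    by (rule bij_betw_byWitness[where f' = "reversal n"]) (auto simp: reversal_def)
qed (simp add: reversal_def del: atLeastAtMost_iff)

lemma perm_length_reversal: "perm_length n (reversal n) = n choose 2"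
proof -
  have "inversions n (reversal n) = {(i, j). i \<in> {1..n} \<and> j \<in> {1..n} \<and> i < j}"
    by (auto simp: inversions_def reversal_def)
  then show ?thesis
    by (simp only: perm_length_def card_ordered_pairs)
qed

lemma strict_antimono_permutes_eq_reversal:
  assumes w: "w permutes {1..n}"
    and dec: "\<And>i j. i \<in> {1..n} \<Longrightarrow> j \<in> {1..n} \<Longrightarrow> i < j \<Longrightarrow> w j < w i"
  shows "w = reversal n"
proof
  fix i
  show "w i = reversal n i"
  proof (cases "i \<in> {1..n}")
    case True
    have inj: "inj_on w A" for A
      using permutes_inj[OF w] by (rule inj_on_subset) simp
    have range: "w j \<in> {1..n}" if "j \<in> {1..n}" for j
      using permutes_in_image[OF w] that by blast
    have "w ` {i..n} \<subseteq> {1..w i}"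
    proof
      fix y assume "y \<in> w ` {i..n}"
      then obtain j where j: "j \<in> {i..n}" "y = w j" by auto
      then show "y \<in> {1..w i}"
        using dec[of i j] range[of j] True by (cases "i = j") auto
    qed
    then have "card (w ` {i..n}) \<le> w i"
      using card_mono[of "{1..w i}"] by fastforce
    moreover have "w ` {1..i} \<subseteq> {w i..n}"
    proof
      fix y assume "y \<in> w ` {1..i}"
      then obtain j where j: "j \<in> {1..i}" "y = w j" by auto
      then show "y \<in> {w i..n}"
        using dec[of j i] range[of j] True by (cases "i = j") auto
    qed
    then have "card (w ` {1..i}) \<le> n + 1 - w i"
      using card_mono[of "{w i..n}"] by fastforce
    ultimately show ?thesis
      using True range[OF True] by (auto simp: card_image[OF inj] reversal_def)
  next
    case False
    then show ?thesis
      using permutes_not_in[OF w] by (simp add: reversal_def del: atLeastAtMost_iff)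
  qed
qed

text \<open>The definite description of \<open>w\<^sub>0\<close> is well defined.\<close>

lemma longest_element_eq_reversal: "longest_element n = reversal n"
  unfolding longest_element_def
proof (rule the_equality)
  have "perm_length n v \<le> n choose 2" if "v permutes {1..n}" for v
    using perm_length_plus_defect[OF that] by simp
  then show "reversal n permutes {1..n} \<and>
      (\<forall>v. v permutes {1..n} \<longrightarrow> perm_length n v \<le> perm_length n (reversal n))"
    using reversal_permutes[of n] perm_length_reversal[of n] by simp
next
  fix w
  assume *: "w permutes {1..n} \<and>
      (\<forall>v. v permutes {1..n} \<longrightarrow> perm_length n v \<le> perm_length n w)"
  then have "n choose 2 \<le> perm_length n w"
    using reversal_permutes[of n] perm_length_reversal[of n] by force
  then have "card {(i::nat, j). i \<in> {1..n} \<and> j \<in> {1..n} \<and> i < j} \<le> card (inversions n w)"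
    by (simp only: card_ordered_pairs perm_length_def)
  moreover have "inversions n w \<subseteq> {(i, j). i \<in> {1..n} \<and> j \<in> {1..n} \<and> i < j}"
    by (auto simp: inversions_def)
  ultimately have "inversions n w = {(i, j). i \<in> {1..n} \<and> j \<in> {1..n} \<and> i < j}"
    by (intro card_seteq finite_ordered_pairs)
  then have "w j < w i" if "i \<in> {1..n}" "j \<in> {1..n}" "i < j" for i j
    using that unfolding inversions_def by blast
  then show "w = reversal n"
    using * by (intro strict_antimono_permutes_eq_reversal) auto
qed

end

theory Submission
  imports Defs
begin

text \<open>
  The idea is to follow \<open>u = inv w\<close> instead of \<open>w\<close>. Since \<open>inv (s\<^sub>i \<circ> w) = u \<circ> s\<^sub>i\<close>, left
  multiplication by \<open>s\<^sub>i\<close> exchanges the entries of \<open>u\<close> in positions \<open>i\<close> and \<open>i + 1\<close>, and it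
  lengthens \<open>w\<close> exactly when these entries increase (\<open>perm_length_transpose_comp_less_iff\<close>).
  So \<open>s\<^sub>i \<star> w\<close> corresponds to the comparator \<open>swap_ascent i\<close>, which puts two neighbouring
  entries in decreasing order.

  The definition of the scan lets \<open>s\<^sub>n\<^sub>-\<^sub>1\<close> act first, so that the comparators run down to
  position 1 and up again, whereas the theorem describes a scan that runs up first. The two
  words are reduced words of the transposition \<open>(1 n)\<close>, apart from a repeated middle letter;
  comparators are idempotent and satisfy the commutation and braid relations, which is enough to
  turn one word into the other (\<open>fold_palindrome_eq\<close>).

  After \<open>t\<close> scans from the identity, \<open>u\<close> is decreasing on the outer \<open>t\<close> positions on each side
  and increasing on the block \<open>t + 1, \<dots>, n - t\<close>. For the next scan, write the palindromic word
  with its outer letters outermost, on the left in the up-down form and on the right in the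
  down-up form. They meet descents both before and after the inner letters have acted, so they do
  nothing. The inner letters act on an increasing block, where they exchange the first and the last
  entry (\<open>fold_swap_ascent_increasing\<close>). Hence each scan multiplies \<open>u\<close> by one more transposition
  of \<open>mirror_product\<close>; being an involution, this product is also the state itself. Lengths are
  then read off from the explicit values \<open>mirror_product_apply\<close>.
\<close>

section \<open>The 0-Hecke relations and palindromic words\<close>

lemma fold_commute_single:
  fixes f :: "'i \<Rightarrow> 'a \<Rightarrow> 'a"
  assumes "\<And>i x. i \<in> set is \<Longrightarrow> f i (f j x) = f j (f i x)"
  shows "fold f is (f j x) = f j (fold f is x)"
  using assms by (induction "is" arbitrary: x) auto

text \<open>
  Both palindromes evaluate the same element of the 0-Hecke monoid. When a letter \<open>c = b + 1\<close> is
  added, the centre \<open>b c c b\<close> of the up-down word becomes \<open>b c b\<close> and, by the braid relation,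
  \<open>c b c\<close>. The two letters \<open>c\<close> commute with all letters below \<open>b\<close> and move to the ends, leaving
  the shorter up-down word between them; the down-up word has this shape from the start.
\<close>

lemma fold_palindrome_eq:
  fixes f :: "nat \<Rightarrow> 'a \<Rightarrow> 'a"
  assumes idem: "\<And>i x. f i (f i x) = f i x"
    and comm: "\<And>i j x. i + 1 < j \<Longrightarrow> f i (f j x) = f j (f i x)"
    and braid: "\<And>i x. f i (f (i + 1) (f i x)) = f (i + 1) (f i (f (i + 1) x))"
  shows "fold f ([a..<c] @ rev [a..<c]) x = fold f (rev [a..<c] @ [a..<c]) x"
proof (induction c arbitrary: x)
  case 0
  show ?case by simp
next
  case (Suc c)
  show ?case
  proof (cases "a < c")
    case False
    then show ?thesis by simp
  next
    case True
    then obtain b where c: "c = Suc b" and ab: "a \<le> b"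
      by (cases c) auto
    have up: "fold f [a..<b] (f c y) = f c (fold f [a..<b] y)" for y
      by (rule fold_commute_single) (rule comm, simp add: c)
    have down: "fold f (rev [a..<b]) (f c y) = f c (fold f (rev [a..<b]) y)" for y
      by (rule fold_commute_single) (rule comm, simp add: c)
    have "fold f ([a..<Suc c] @ rev [a..<Suc c]) x
        = fold f (rev [a..<b]) (f b (f c (f b (fold f [a..<b] x))))"
      using ab by (simp add: c idem)
    also have "\<dots> = fold f (rev [a..<b]) (f c (f b (f c (fold f [a..<b] x))))"
      using braid[of b] by (simp add: c)
    also have "\<dots> = f c (fold f ([a..<c] @ rev [a..<c]) (f c x))"
      using ab by (simp add: up[unfolded c] down[unfolded c] c idem)
    also have "\<dots> = fold f (rev [a..<Suc c] @ [a..<Suc c]) x"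
      using True Suc.IH[of "f c x"] by simp
    finally show ?thesis .
  qed
qed

section \<open>The sorting operators on one-line notation\<close>

definition swap_ascent :: "nat \<Rightarrow> (nat \<Rightarrow> 'a::linorder) \<Rightarrow> nat \<Rightarrow> 'a" where
  "swap_ascent i u = (if u i < u (i + 1) then u \<circ> transpose i (i + 1) else u)"

lemma swap_ascent_idem: "swap_ascent i (swap_ascent i u) = swap_ascent i u"
  by (auto simp: swap_ascent_def)

lemma swap_ascent_commute:
  assumes "i + 1 < j"
  shows "swap_ascent i (swap_ascent j u) = swap_ascent j (swap_ascent i u)"
  using assms by (auto simp: swap_ascent_def fun_eq_iff transpose_def)

text \<open>Either side sorts the three entries in positions \<open>i, i + 1, i + 2\<close> into decreasing order.\<close>

lemma swap_ascent_braid: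
  "swap_ascent i (swap_ascent (i + 1) (swap_ascent i u))
     = swap_ascent (i + 1) (swap_ascent i (swap_ascent (i + 1) u))"
  by (auto simp: swap_ascent_def fun_eq_iff transpose_def)

lemmas swap_ascent_palindrome_eq =
  fold_palindrome_eq[of swap_ascent, OF swap_ascent_idem swap_ascent_commute swap_ascent_braid]

lemma fold_swap_ascent_descents:
  assumes "\<And>i. i \<in> set is \<Longrightarrow> u (i + 1) \<le> u i"
  shows "fold swap_ascent is u = u"
  using assms
proof (induction "is")
  case (Cons a "is")
  have "swap_ascent a u = u"
    using Cons.prems[of a] by (auto simp: swap_ascent_def)
  then show ?case
    using Cons by simp
qed simp

text \<open>
  This is the conjugation \<open>(a c+1) = s\<^sub>c (a c) s\<^sub>c\<close>: each of the three factors finds its two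
  entries in increasing order, so all of them are really carried out.
\<close>

lemma fold_swap_ascent_increasing:
  fixes u :: "nat \<Rightarrow> 'a::linorder"
  assumes "a \<le> c" and "strict_mono_on {a..c} u"
  shows "fold swap_ascent (rev [a..<c] @ [a..<c]) u = u \<circ> transpose a c"
  using assms
proof (induction c arbitrary: u rule: nat_induct_at_least)
  case base
  show ?case by simp
next
  case (Suc c)
  let ?s = "transpose c (c + 1)"
  have less: "u i < u j" if "a \<le> i" "i < j" "j \<le> Suc c" for i j
    using Suc.prems that by (auto simp: strict_mono_on_def)
  have first: "swap_ascent c u = u \<circ> ?s"
    using less[of c "Suc c"] Suc.hyps by (simp add: swap_ascent_def)
  \<comment> \<open>The exchange puts the largest entry at \<open>c\<close>, so the shorter block still increases.\<close>
  have "strict_mono_on {a..c} (u \<circ> ?s)"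
    by (auto simp: strict_mono_on_def transpose_def less)
  then have "fold swap_ascent (rev [a..<c] @ [a..<c]) (u \<circ> ?s) = u \<circ> ?s \<circ> transpose a c"
    by (rule Suc.IH)
  then have "fold swap_ascent (rev [a..<Suc c] @ [a..<Suc c]) u
      = swap_ascent c (u \<circ> ?s \<circ> transpose a c)"
    using Suc.hyps first by simp
  also have "\<dots> = u \<circ> transpose a (Suc c)"
  proof (cases "a = c")
    case True
    then show ?thesis
      using less[of c "Suc c"] by (auto simp: swap_ascent_def)
  next
    case False
    \<comment> \<open>The block scan has left \<open>u a\<close> in position \<open>c\<close> and \<open>u c\<close> in position \<open>c + 1\<close>.\<close>
    then have "a < c"
      using Suc.hyps by simp
    then show ?thesis
      using less[of a c] by (auto simp: swap_ascent_def fun_eq_iff transpose_def)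
  qed
  finally show ?case .
qed

lemma one_line_swap_ascent:
  assumes "i \<in> {1..<n}"
  shows "one_line n (swap_ascent i u) = compare_swap i (one_line n u)"
proof (rule nth_equalityI)
  fix k
  assume "k < length (one_line n (swap_ascent i u))"
  then show "one_line n (swap_ascent i u) ! k = compare_swap i (one_line n u) ! k"
    using assms
    by (auto simp: one_line_def compare_swap_def swap_ascent_def Let_def nth_list_update
        transpose_def simp del: upt_Suc)
qed (simp add: one_line_def compare_swap_def Let_def)

lemma one_line_fold_swap_ascent:
  assumes "set is \<subseteq> {1..<n}"
  shows "one_line n (fold swap_ascent is u) = fold compare_swap is (one_line n u)"
  using assms by (induction "is" arbitrary: u) (auto simp: one_line_swap_ascent)

section \<open>The star action on inverses\<close>

text \<open>
  Exchanging the adjacent values \<open>i\<close> and \<open>i + 1\<close> does not change how either compares with a third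
  value, so only the pair of positions where they occur changes its status.
\<close>

lemma inversions_transpose_comp:
  assumes w: "w permutes {1..n}" and i: "i \<in> {1..<n}" and less: "inv w i < inv w (i + 1)"
  shows "inversions n (transpose i (i + 1) \<circ> w) = insert (inv w i, inv w (i + 1)) (inversions n w)"
    and "(inv w i, inv w (i + 1)) \<notin> inversions n w"
proof -
  let ?p = "inv w i" and ?q = "inv w (i + 1)"
  have wp: "w x = i \<longleftrightarrow> x = ?p" and wq: "w x = i + 1 \<longleftrightarrow> x = ?q" for x
    using permutes_inverses[OF w] by metis+
  have mem: "?p \<in> {1..n}" "?q \<in> {1..n}"
    using permutes_in_image[OF permutes_inv[OF w]] i by auto
  have "(x, y) \<in> inversions n (transpose i (i + 1) \<circ> w)
      \<longleftrightarrow> (x, y) = (?p, ?q) \<or> (x, y) \<in> inversions n w" for x y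
  proof -
    consider "x = ?p" "y = ?q" | "x = ?q" "y = ?p"
      | "x = ?p" "y \<noteq> ?p" "y \<noteq> ?q" | "x = ?q" "y \<noteq> ?p" "y \<noteq> ?q"
      | "y = ?p" "x \<noteq> ?p" "x \<noteq> ?q" | "y = ?q" "x \<noteq> ?p" "x \<noteq> ?q"
      | "x = y" | "x \<noteq> ?p" "x \<noteq> ?q" "y \<noteq> ?p" "y \<noteq> ?q"
      by blast
    then show ?thesis
      using wp[of x] wp[of y] wq[of x] wq[of y] mem less
      by cases (auto simp: inversions_def transpose_def)
  qed
  then show "inversions n (transpose i (i + 1) \<circ> w) = insert (?p, ?q) (inversions n w)"
    by auto
  show "(?p, ?q) \<notin> inversions n w"
    using permutes_inverses[OF w] by (simp add: inversions_def)
qed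

lemma finite_inversions: "finite (inversions n w)"
  by (rule finite_subset[OF _ finite_ordered_pairs[of n]]) (auto simp: inversions_def)

lemma perm_length_transpose_comp_less:
  assumes w: "w permutes {1..n}" and i: "i \<in> {1..<n}" and less: "inv w i < inv w (i + 1)"
  shows "perm_length n w < perm_length n (transpose i (i + 1) \<circ> w)"
  unfolding perm_length_def
  using inversions_transpose_comp[OF assms] finite_inversions[of n w] by simp

lemma transpose_permutes:
  fixes i :: nat
  assumes "i \<in> {1..<n}"
  shows "transpose i (i + 1) permutes {1..n}"
  using assms by (intro permutes_swap_id) auto

lemma inv_transpose_comp:
  assumes "w permutes S"
  shows "inv (transpose i j \<circ> w) = inv w \<circ> transpose i j"
  using permutes_bij[OF assms] by (simp add: o_inv_distrib)

lemma perm_length_transpose_comp_less_iff: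
  assumes w: "w permutes {1..n}" and i: "i \<in> {1..<n}"
  shows "perm_length n w < perm_length n (transpose i (i + 1) \<circ> w) \<longleftrightarrow> inv w i < inv w (i + 1)"
proof
  assume lt: "perm_length n w < perm_length n (transpose i (i + 1) \<circ> w)"
  show "inv w i < inv w (i + 1)"
  proof (rule ccontr)
    \<comment> \<open>Otherwise \<open>w\<close> arises from \<open>?v\<close> by a lengthening multiplication with \<open>s\<^sub>i\<close>.\<close>
    let ?v = "transpose i (i + 1) \<circ> w"
    assume "\<not> inv w i < inv w (i + 1)"
    moreover have "inv w i \<noteq> inv w (i + 1)"
      using permutes_inj[OF permutes_inv[OF w]] by (auto dest: injD)
    ultimately have "inv ?v i < inv ?v (i + 1)"
      by (simp add: inv_transpose_comp[OF w])
    moreover have "?v permutes {1..n}"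
      by (rule permutes_compose[OF w transpose_permutes[OF i]])
    ultimately have "perm_length n ?v < perm_length n (transpose i (i + 1) \<circ> ?v)"
      using i by (intro perm_length_transpose_comp_less)
    then show False
      using lt by (simp add: o_assoc)
  qed
qed (rule perm_length_transpose_comp_less[OF assms])

lemma star_action_permutes:
  assumes w: "w permutes {1..n}" and i: "i \<in> {1..<n}"
  shows "star_action n i w permutes {1..n}"
  using permutes_compose[OF w transpose_permutes[OF i]] w
  by (simp add: star_action_def Let_def)

lemma inv_star_action:
  assumes w: "w permutes {1..n}" and i: "i \<in> {1..<n}"
  shows "inv (star_action n i w) = swap_ascent i (inv w)"
  using perm_length_transpose_comp_less_iff[OF assms]
  by (simp add: star_action_def swap_ascent_def Let_def inv_transpose_comp[OF w])

lemma fold_star_action: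
  assumes "w permutes {1..n}" and "set is \<subseteq> {1..<n}"
  shows "fold (star_action n) is w permutes {1..n}
    \<and> inv (fold (star_action n) is w) = fold swap_ascent is (inv w)"
  using assms
proof (induction "is" arbitrary: w)
  case (Cons i "is")
  then have i: "i \<in> {1..<n}" by simp
  show ?case
    using Cons.IH[OF star_action_permutes[OF Cons.prems(1) i]] Cons.prems
    by (simp add: inv_star_action[OF Cons.prems(1) i])
qed simp

lemma short_scan_permutes:
  assumes "w permutes {1..n}"
  shows "short_scan n w permutes {1..n}"
  using fold_star_action[OF assms, of "rev [1..<n] @ [1..<n]"]
  by (simp add: short_scan_def foldr_conv_fold)

text \<open>
  The definition of the scan yields the down-up order of comparators; the order given here comes
  from the equality of the two palindromes.
\<close>

lemma inv_short_scan:
  assumes "w permutes {1..n}"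
  shows "inv (short_scan n w) = fold swap_ascent ([1..<n] @ rev [1..<n]) (inv w)"
  using fold_star_action[OF assms, of "rev [1..<n] @ [1..<n]"]
  by (simp add: short_scan_def foldr_conv_fold swap_ascent_palindrome_eq del: fold_append)

lemma short_scan_funpow_permutes: "(short_scan n ^^ t) id permutes {1..n}"
proof (induction t)
  case 0
  show ?case by (simp only: funpow_0 permutes_id)
next
  case (Suc t)
  then show ?case
    using short_scan_permutes by (simp only: funpow.simps comp_apply)
qed

section \<open>Partial reversals\<close>

lemma mirror_product_Suc:
  "mirror_product n (Suc t) = mirror_product n t \<circ> transpose (Suc t) (n - t)"
proof -
  have "foldr (\<circ>) fs g = foldr (\<circ>) fs id \<circ> g" for fs and g :: "nat \<Rightarrow> nat"
    by (induction fs) auto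
  from this[of _ "transpose (Suc t) (n - t)"] show ?thesis
    by (simp add: mirror_product_def)
qed

lemma mirror_product_apply:
  assumes "t \<le> n div 2"
  shows "mirror_product n t i
    = (if i \<in> {1..t} \<union> {n - t + 1..n} then n + 1 - i else i)"
  using assms
proof (induction t arbitrary: i)
  case 0
  then show ?case by (simp add: mirror_product_def)
next
  case (Suc t)
  then show ?case
    by (auto simp: mirror_product_Suc transpose_def)
qed

lemma inv_mirror_product:
  assumes "t \<le> n div 2"
  shows "inv (mirror_product n t) = mirror_product n t"
  by (rule inv_equality) (use assms in \<open>auto simp: mirror_product_apply\<close>)

lemma mirror_product_half: "mirror_product n (n div 2) = reversal n"
  by (auto simp: fun_eq_iff mirror_product_apply reversal_def)

lemma mirror_product_neq_reversal:
  assumes "t < n div 2"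
  shows "mirror_product n t \<noteq> reversal n"
proof
  assume "mirror_product n t = reversal n"
  then have "mirror_product n t (Suc t) = reversal n (Suc t)" by simp
  then show False
    using assms by (simp add: mirror_product_apply reversal_def split: if_splits)
qed

lemma card_increasing_pairs:
  "card {(i::nat, j). i \<in> {a + 1..a + m} \<and> j \<in> {a + 1..a + m} \<and> i < j} = m choose 2"
proof -
  have "bij_betw (\<lambda>(i, j). (i + a, j + a)) {(i::nat, j). i \<in> {1..m} \<and> j \<in> {1..m} \<and> i < j}
      {(i, j). i \<in> {a + 1..a + m} \<and> j \<in> {a + 1..a + m} \<and> i < j}"
    by (rule bij_betw_byWitness[where f' = "\<lambda>(i, j). (i - a, j - a)"]) auto
  then show ?thesis
    using card_ordered_pairs[of m] by (simp only: bij_betw_same_card[symmetric])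
qed

text \<open>
  A pair of positions with at least one outside the central block is inverted, so the
  non-inversions are exactly the pairs inside the block.
\<close>

lemma perm_defect_mirror_product:
  assumes "t \<le> n div 2"
  shows "perm_defect n (mirror_product n t) = (n - 2 * t) choose 2"
proof -
  have "non_inversions n (mirror_product n t)
      = {(i, j). i \<in> {t + 1..t + (n - 2 * t)} \<and> j \<in> {t + 1..t + (n - 2 * t)} \<and> i < j}"
    using assms by (auto simp: non_inversions_def mirror_product_apply split: if_splits)
  then show ?thesis
    by (simp only: perm_defect_def card_increasing_pairs)
qed

lemma upt_split:
  assumes "a \<le> b" and "b \<le> c"
  shows "[a..<c] = [a..<b] @ [b..<c]"
  using upt_add_eq_append[OF assms(1), of "c - b"] assms(2) by simp

lemma filter_one_line_mirror_product:
  assumes t: "t \<le> n div 2"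
  shows "filter (\<lambda>v. v \<in> {t + 1..n - t}) (one_line n (mirror_product n t)) = [t + 1..<n - t + 1]"
proof -
  let ?m = "mirror_product n t" and ?P = "\<lambda>v. v \<in> {t + 1..n - t}"
  have "[1..<n + 1] = [1..<t + 1] @ [t + 1..<n - t + 1] @ [n - t + 1..<n + 1]"
    using t upt_split[of 1 "t + 1" "n + 1"]
      upt_split[of "t + 1" "n - t + 1" "n + 1"] by simp
  moreover have "filter ?P (map ?m [1..<t + 1]) = []"
    using t by (auto simp: filter_empty_conv mirror_product_apply simp del: upt_Suc)
  moreover have "filter ?P (map ?m [n - t + 1..<n + 1]) = []"
    using t by (auto simp: filter_empty_conv mirror_product_apply simp del: upt_Suc)
  moreover have "map ?m [t + 1..<n - t + 1] = [t + 1..<n - t + 1]"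
    using t by (intro map_idI) (auto simp: mirror_product_apply)
  moreover have "filter ?P [t + 1..<n - t + 1] = [t + 1..<n - t + 1]"
    by (auto simp: filter_id_conv simp del: upt_Suc)
  ultimately show ?thesis
    by (simp only: one_line_def map_append filter_append append_Nil append_Nil2)
qed

text \<open>
  The recursion \<open>mirror_product_Suc\<close> exchanges two positions. Before the step each of these
  positions holds its own number, so the same step is an exchange of values.
\<close>

lemma one_line_mirror_product_Suc:
  assumes "Suc t \<le> n div 2"
  shows "one_line n (mirror_product n (Suc t))
    = map (transpose (Suc t) (n - t)) (one_line n (mirror_product n t))"
  using assms
  by (auto simp: one_line_def mirror_product_apply transpose_def simp del: upt_Suc)

section \<open>Iterating the scan from the identity\<close>

text \<open>
  Outside the block \<open>{t + 1..n - t}\<close> both the old and the new arrangement descend, which makes the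
  outer letters of the word act trivially at its start and at its end. Peeling them off on the left
  uses the up-down form and on the right the down-up form of the palindrome.
\<close>

lemma scan_mirror_product:
  assumes t: "t < n div 2"
  shows "fold swap_ascent ([1..<n] @ rev [1..<n]) (mirror_product n t) = mirror_product n (Suc t)"
proof -
  let ?m = "mirror_product n t" and ?m' = "mirror_product n (Suc t)"
  let ?a = "Suc t" and ?c = "n - t"
  let ?f = "fold (swap_ascent :: nat \<Rightarrow> (nat \<Rightarrow> nat) \<Rightarrow> _)"
  \<comment> \<open>The block ends \<open>t\<close> and \<open>n - t\<close> are descents too, since each outer entry on the left exceeds
    and each one on the right is below the whole block.\<close>
  have descents: "?m (i + 1) \<le> ?m i" "?m' (i + 1) \<le> ?m' i" if "i \<in> {1..<?a} \<union> {?c..<n}" for i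
    using t that by (auto simp: mirror_product_apply)
  have fixed: "?f is ?m = ?m" "?f is ?m' = ?m'" if "set is \<subseteq> {1..<?a} \<union> {?c..<n}" for "is"
    using that descents by (intro fold_swap_ascent_descents; blast)+
  have left: "[1..<n] = [1..<?a] @ [?a..<n]"
    using t upt_split[of 1 ?a n] by simp
  have right: "[?a..<n] = [?a..<?c] @ [?c..<n]"
    using t upt_split[of ?a ?c n] by simp
  have "strict_mono_on {?a..?c} ?m"
    using t by (auto simp: strict_mono_on_def mirror_product_apply)
  then have "?f (rev [?a..<?c] @ [?a..<?c]) ?m = ?m'"
    using t fold_swap_ascent_increasing[of ?a ?c ?m] by (simp add: mirror_product_Suc)
  then have "?f (rev [?a..<n] @ [?a..<n]) ?m = ?m'"
    unfolding right by (simp add: fixed del: upt_Suc)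
  then have "?f ([?a..<n] @ rev [?a..<n]) ?m = ?m'"
    by (simp only: swap_ascent_palindrome_eq)
  then show ?thesis
    unfolding left by (simp add: fixed del: upt_Suc)
qed

lemma short_scan_mirror_product:
  assumes "t \<le> n div 2"
  shows "(short_scan n ^^ t) id = mirror_product n t"
  using assms
proof (induction t)
  case 0
  then show ?case by (simp add: mirror_product_def)
next
  case (Suc t)
  let ?w = "(short_scan n ^^ t) id"
  have w: "?w permutes {1..n}"
    by (rule short_scan_funpow_permutes)
  have eq: "?w = mirror_product n t"
    by (rule Suc.IH) (use Suc.prems in linarith)
  have "inv (short_scan n ?w) = mirror_product n (Suc t)"
    using Suc.prems w scan_mirror_product[of t n]
    by (simp add: inv_short_scan eq inv_mirror_product del: fold_append)
  moreover have "inv (inv (short_scan n ?w)) = short_scan n ?w"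
    by (rule inv_inv_eq) (rule permutes_bij[OF short_scan_permutes[OF w]])
  ultimately show ?case
    using inv_mirror_product[OF Suc.prems] by (simp only: funpow.simps comp_apply)
qed

lemma choose_two_diff:
  assumes "2 * t \<le> n"
  shows "int (n choose 2) - int ((n - 2 * t) choose 2) = 2 * int t * int n - 2 * (int t)\<^sup>2 - int t"
proof -
  obtain m where n: "n = m + 2 * t"
    using assms by (metis add.commute le_Suc_ex)
  have twice: "2 * int (k choose 2) = int k * (int k - 1)" for k
  proof -
    have "2 * (k choose 2) = k * (k - 1)"
      unfolding choose_two by (rule dvd_mult_div_cancel) (cases k; simp)
    then have "int (2 * (k choose 2)) = int (k * (k - 1))"
      by (rule arg_cong)
    then show ?thesis
      by (cases k) (simp_all add: algebra_simps)
  qed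
  have "2 * (int (n choose 2) - int (m choose 2)) = 2 * (2 * int t * int n - 2 * (int t)\<^sup>2 - int t)"
    by (simp add: right_diff_distrib twice n power2_eq_square algebra_simps)
  then show ?thesis
    by (simp add: n)
qed
theorem corollary5p2:
  fixes n :: nat
  assumes "n \<ge> 2"
  shows
    "(\<forall>w. w permutes {1..n} \<longrightarrow>
        short_scan n w permutes {1..n} \<and>
        one_line n (inv (short_scan n w)) =
          fold compare_swap ([1..<n] @ rev [1..<n]) (one_line n (inv w)))
     \<and> (\<forall>t. 1 \<le> t \<and> t \<le> n div 2 \<longrightarrow>
        one_line n (inv ((short_scan n ^^ t) id)) =
          map (transpose t (n + 1 - t)) (one_line n (inv ((short_scan n ^^ (t - 1)) id)))
        \<and> (short_scan n ^^ t) id = mirror_product n t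
        \<and> card {t + 1..n - t} = n - 2 * t
        \<and> filter (\<lambda>v. v \<in> {t + 1..n - t}) (one_line n (inv ((short_scan n ^^ t) id)))
            = [t + 1..<n - t + 1]
        \<and> perm_defect n ((short_scan n ^^ t) id) = (n - 2 * t) choose 2
        \<and> int (perm_length n ((short_scan n ^^ t) id))
            = int (n choose 2) - int ((n - 2 * t) choose 2)
        \<and> int (n choose 2) - int ((n - 2 * t) choose 2)
            = 2 * int t * int n - 2 * (int t)\<^sup>2 - int t)
     \<and> (short_scan n ^^ (n div 2)) id = longest_element n
     \<and> (\<forall>t < n div 2. (short_scan n ^^ t) id \<noteq> longest_element n)"
proof (intro conjI allI impI)
  fix w :: "nat \<Rightarrow> nat"
  assume w: "w permutes {1..n}"
  show "short_scan n w permutes {1..n}"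
    by (rule short_scan_permutes[OF w])
  show "one_line n (inv (short_scan n w))
      = fold compare_swap ([1..<n] @ rev [1..<n]) (one_line n (inv w))"
    unfolding inv_short_scan[OF w] by (rule one_line_fold_swap_ascent) auto
next
  fix t
  assume t: "1 \<le> t \<and> t \<le> n div 2"
  then obtain s where s: "t = Suc s"
    by (cases t) auto
  have state: "(short_scan n ^^ t) id = mirror_product n t"
      "(short_scan n ^^ (t - 1)) id = mirror_product n (t - 1)"
    by (rule short_scan_mirror_product, use t in linarith)+
  have inverse: "inv (mirror_product n t) = mirror_product n t"
      "inv (mirror_product n (t - 1)) = mirror_product n (t - 1)"
    by (rule inv_mirror_product, use t in linarith)+
  show "one_line n (inv ((short_scan n ^^ t) id))
      = map (transpose t (n + 1 - t)) (one_line n (inv ((short_scan n ^^ (t - 1)) id)))"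
    unfolding state inverse using t one_line_mirror_product_Suc[of s n] by (simp add: s)
  show "(short_scan n ^^ t) id = mirror_product n t"
    by (rule state)
  show "card {t + 1..n - t} = n - 2 * t"
    by simp
  show "filter (\<lambda>v. v \<in> {t + 1..n - t}) (one_line n (inv ((short_scan n ^^ t) id)))
      = [t + 1..<n - t + 1]"
    unfolding state inverse by (rule filter_one_line_mirror_product) (use t in linarith)
  show defect: "perm_defect n ((short_scan n ^^ t) id) = (n - 2 * t) choose 2"
    unfolding state by (rule perm_defect_mirror_product) (use t in linarith)
  show "int (perm_length n ((short_scan n ^^ t) id))
      = int (n choose 2) - int ((n - 2 * t) choose 2)"
    using perm_length_plus_defect[OF short_scan_funpow_permutes[of t n]] defect by linarith
  show "int (n choose 2) - int ((n - 2 * t) choose 2)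
      = 2 * int t * int n - 2 * (int t)\<^sup>2 - int t"
    by (rule choose_two_diff) (use t in linarith)
next
  show "(short_scan n ^^ (n div 2)) id = longest_element n"
    by (simp add: short_scan_mirror_product mirror_product_half longest_element_eq_reversal)
next
  fix t
  assume "t < n div 2"
  then show "(short_scan n ^^ t) id \<noteq> longest_element n"
    by (simp add: short_scan_mirror_product mirror_product_neq_reversal
        longest_element_eq_reversal)
qed

end
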